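(* Let $\alpha=(\alpha_1,\dots,\alpha_s)$ be a composition with $\alpha_1,\alpha_s\ge 2$, and let $F=\breve F(\alpha)$ be the corresponding fence. Then the following hold for rowmotion on $F$ (statistics $\chi$ refer to rowmotion orbits on antichains, statistics $\hat\chi$ refer to rowmotion orbits on ideals). (a) If $x,y\in\breve S_i$ for some $i$, then $\chi_x-\chi_y$ is $0$-mesic. (b) If $x\in\breve S_i$, $y=s_i$ and $z=s_{i-1}$, then $\alpha_i\chi_x+\chi_y+\chi_z$ is $1$-mesic (where $\chi_{s_0}$ and $\chi_{s_s}$ are interpreted as $0$). (c) If $x=s_{1,j}$ and $y=s_{1,k}$, then $k\hat\chi_x-j\hat\chi_y$ is $(k-j)$-mesic. (d) Let $x=s_{2i-1}$ and $y=s_{2j}$. If $r_{2i-1}(\mathcal O)=r_{2j}(\mathcal O)$ for all orbits $\mathcal O$, then $\hat\chi_x+\hat\chi_y$ is $1$-mesic. (e) If $s$ is odd and all the $\alpha_i$ are even, then $\#\mathcal O$ is even for all orbits $\mathcal O$. (f) If $\alpha_i=2$ for all $i\in[s]$, then $\chi$ is $s/2$-mesic.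
   Context: Fences. For a composition $\alpha=(\alpha_1,\dots,\alpha_s)$ (a finite sequence of positive integers) with $\alpha_1,\alpha_s\ge2$, put $p_0=0$, $p_i=\alpha_1+\dots+\alpha_i$ and $n=p_s-1$. The fence $\breve F(\alpha)$ is the poset on $\{x_1,\dots,x_n\}$ with covering relations, for $1\le k<n$ and $i$ such that $p_{i-1}\le k<p_i$: $x_k\lhd x_{k+1}$ if $i$ is odd, and $x_k\rhd x_{k+1}$ if $i$ is even. Thus $x_1\lhd\cdots\lhd x_{p_1}\rhd\cdots\rhd x_{p_2}\lhd\cdots$. The $i$th segment $S_i$ is the chain consisting of the $x_k$ with $p_{i-1}\le k\le p_i$, $1\le k\le n$. For $1\le i\le s-1$, $s_i=x_{p_i}$ is the unique (shared) element of $S_i\cap S_{i+1}$ (maximal in the fence if $i$ is odd, minimal if $i$ is even). $\breve S_i$ is the set of the $\alpha_i-1$ unshared elements of $S_i$ (those lying in no other segment), and $s_{i,j}$, $1\le j\le\alpha_i-1$, is the $j$th smallest element of $\breve S_i$ in the poset order. Rowmotion. For a finite poset $P$, $\mathcal A(P)$ and $\mathcal I(P)$ denote its sets of antichains and (lower order) ideals. Rowmotion on antichains is the bijection $\rho:\mathcal A(P)\to\mathcal A(P)$ sending $A$ to the set of minimal elements of $P\setminus I$, where $I$ is the ideal generated by $A$. Rowmotion on ideals is the bijection $\hat\rho:\mathcal I(P)\to\mathcal I(P)$ sending $I$ to the ideal generated by the minimal elements of $P\setminus I$. Orbits are orbits of the cyclic groups generated by these maps; $A\mapsto$ (ideal generated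 by $A$) gives a size-preserving bijection between orbits of $\rho$ and of $\hat\rho$, and both orbits are denoted $\mathcal O$. Statistics. $\chi_x(A)=1$ if $x\in A$ and $0$ otherwise; $\chi(A)=\#A$; $\hat\chi_x(I)=1$ if $x\in I$ and $0$ otherwise. For a statistic $\mathrm{st}$ (real-valued function), $\mathrm{st}(\mathcal O)=\sum_{y\in\mathcal O}\mathrm{st}(y)$. A statistic is $d$-mesic if $\mathrm{st}(\mathcal O)/\#\mathcal O=d$ for every orbit $\mathcal O$. For an orbit $\mathcal O$ of antichains and $1\le i\le s-1$, $r_i(\mathcal O)$ is the number of antichains in $\mathcal O$ containing $s_i$ (the number of red tiles with top square in row $i$ in the tiling picturing $\mathcal O$). *)

theory Defs
  imports Complex_Main "HOL-Library.Indicator_Function" "HOL-Combinatorics.Orbits"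
begin

section \<open>Rowmotion on a finite poset\<close>

text \<open>A poset is a reflexive order relation \<open>r\<close> on \<open>Field r\<close>. Its ideals are the sets \<open>I\<close>
  with \<open>Order_Relation.ofilter r I\<close>, and \<open>(x, y) \<in> r\<close> is read as \<open>x \<le> y\<close>.\<close>

definition antichains :: "'a rel \<Rightarrow> 'a set set" where
  "antichains r = {A. A \<subseteq> Field r \<and> (\<forall>x\<in>A. \<forall>y\<in>A. (x, y) \<in> r \<longrightarrow> x = y)}"

definition ideals :: "'a rel \<Rightarrow> 'a set set" where
  "ideals r = {I. ofilter r I}"

definition ideal_gen :: "'a rel \<Rightarrow> 'a set \<Rightarrow> 'a set" where
  "ideal_gen r A = (\<Union>a\<in>A. under r a)"

definition minimals :: "'a rel \<Rightarrow> 'a set \<Rightarrow> 'a set" where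
  "minimals r X = {x\<in>X. \<forall>y\<in>X. (y, x) \<in> r \<longrightarrow> y = x}"

definition row_antichain :: "'a rel \<Rightarrow> 'a set \<Rightarrow> 'a set" where
  "row_antichain r A = minimals r (Field r - ideal_gen r A)"

definition row_ideal :: "'a rel \<Rightarrow> 'a set \<Rightarrow> 'a set" where
  "row_ideal r I = ideal_gen r (minimals r (Field r - I))"

text \<open>\<open>orbit f x\<close> consists of the images of \<open>x\<close> under the positive powers of \<open>f\<close>. For a finite
  poset both rowmotion maps are bijections of finite sets (\<open>bij_betw_row_antichain\<close> and
  \<open>bij_betw_row_ideal\<close> below; \<open>partial_order_on_fence\<close> makes
  them applicable), so this is the orbit under the cyclic group generated by \<open>f\<close>.\<close>

definition antichain_orbits :: "'a rel \<Rightarrow> 'a set set set" where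
  "antichain_orbits r = orbit (row_antichain r) ` antichains r"

definition ideal_orbits :: "'a rel \<Rightarrow> 'a set set set" where
  "ideal_orbits r = orbit (row_ideal r) ` ideals r"

definition mesic :: "'b set set \<Rightarrow> ('b \<Rightarrow> real) \<Rightarrow> real \<Rightarrow> bool" where
  "mesic \<O>s st d \<longleftrightarrow> (\<forall>\<O>\<in>\<O>s. (\<Sum>y\<in>\<O>. st y) / real (card \<O>) = d)"

text \<open>The same indicator serves for antichains and for ideals; which of the two is meant is
  determined by the family of orbits passed to \<open>mesic\<close>.\<close>

definition chi :: "'a \<Rightarrow> 'a set \<Rightarrow> real" where
  "chi x A = indicator A x"

section \<open>Fences\<close>

text \<open>The element $x_k$ of a fence is represented by the number \<open>k\<close>. Parts and segments are
  counted from 1, so $\alpha_i$ is \<open>\<alpha> ! (i - 1)\<close>.\<close>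

definition fence_composition :: "nat list \<Rightarrow> bool" where
  "fence_composition \<alpha> \<longleftrightarrow>
     \<alpha> \<noteq> [] \<and> (\<forall>a\<in>set \<alpha>. 0 < a) \<and> 2 \<le> hd \<alpha> \<and> 2 \<le> last \<alpha>"

definition psum :: "nat list \<Rightarrow> nat \<Rightarrow> nat" where
  "psum \<alpha> i = sum_list (take i \<alpha>)"

definition fence_size :: "nat list \<Rightarrow> nat" where
  "fence_size \<alpha> = psum \<alpha> (length \<alpha>) - 1"

definition fence_covers :: "nat list \<Rightarrow> nat rel" where
  "fence_covers \<alpha> =
     {(k, k + 1) | k i. 1 \<le> k \<and> k < fence_size \<alpha> \<and> i \<in> {1..length \<alpha>} \<and>
        psum \<alpha> (i - 1) \<le> k \<and> k < psum \<alpha> i \<and> odd i} \<union>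
     {(k + 1, k) | k i. 1 \<le> k \<and> k < fence_size \<alpha> \<and> i \<in> {1..length \<alpha>} \<and>
        psum \<alpha> (i - 1) \<le> k \<and> k < psum \<alpha> i \<and> even i}"

definition fence :: "nat list \<Rightarrow> nat rel" where
  "fence \<alpha> = Id_on {1..fence_size \<alpha>} \<union> (fence_covers \<alpha>)\<^sup>+"

definition segment :: "nat list \<Rightarrow> nat \<Rightarrow> nat set" where
  "segment \<alpha> i = {k \<in> {1..fence_size \<alpha>}. psum \<alpha> (i - 1) \<le> k \<and> k \<le> psum \<alpha> i}"

definition unshared :: "nat list \<Rightarrow> nat \<Rightarrow> nat set" where
  "unshared \<alpha> i = segment \<alpha> i - (\<Union>j\<in>{1..length \<alpha>} - {i}. segment \<alpha> j)"

text \<open>$s_i$, which is an element of the fence only for $1 \le i \le s - 1$.\<close>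

definition shared_elem :: "nat list \<Rightarrow> nat \<Rightarrow> nat" where
  "shared_elem \<alpha> i = psum \<alpha> i"

text \<open>$\chi_{s_i}$, with the convention that it is 0 for \<open>i = 0\<close> and \<open>i = length \<alpha>\<close>.\<close>

definition chi_shared :: "nat list \<Rightarrow> nat \<Rightarrow> nat set \<Rightarrow> real" where
  "chi_shared \<alpha> i A =
     (if 1 \<le> i \<and> i \<le> length \<alpha> - 1 then chi (shared_elem \<alpha> i) A else 0)"

text \<open>$s_{i,j}$: the set of unshared elements of a segment is a chain, so its \<open>j\<close>th smallest element
  is the one with exactly \<open>j\<close> elements of that set weakly below it.\<close>

definition unshared_elem :: "nat list \<Rightarrow> nat \<Rightarrow> nat \<Rightarrow> nat" where
  "unshared_elem \<alpha> i j =
     (THE x. x \<in> unshared \<alpha> i \<and> card (under (fence \<alpha>) x \<inter> unshared \<alpha> i) = j)"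

text \<open>$r_i(\mathcal{O})$ for an orbit of antichains.\<close>

definition red_count :: "nat list \<Rightarrow> nat \<Rightarrow> nat set set \<Rightarrow> nat" where
  "red_count \<alpha> i \<O> = card {A\<in>\<O>. shared_elem \<alpha> i \<in> A}"

section \<open>The fence is a finite poset\<close>

lemma psum_mono: "i \<le> j \<Longrightarrow> psum \<alpha> i \<le> psum \<alpha> j"
  unfolding psum_def by (metis le_add1 le_add_diff_inverse sum_list_append take_add)

text \<open>The height of \<open>k\<close> is the number of ascending minus the number of descending steps of the
  fence before \<open>k\<close>; it increases along every covering relation.\<close>

lemma fence_covers_height:
  obtains h :: "nat \<Rightarrow> int" where "\<And>x y. (x, y) \<in> fence_covers \<alpha> \<Longrightarrow> h x < h y"
proof -
  define up where "up k \<longleftrightarrow> (\<exists>i. odd i \<and> psum \<alpha> (i - 1) \<le> k \<and> k < psum \<alpha> i)" for k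
  define h :: "nat \<Rightarrow> int" where "h k = (\<Sum>m<k. if up m then 1 else - 1)" for k
  have *: "\<not> up k" if "even i" "psum \<alpha> (i - 1) \<le> k" "k < psum \<alpha> i" for i k
  proof
    assume "up k"
    then obtain j where j: "odd j" "psum \<alpha> (j - 1) \<le> k" "k < psum \<alpha> j"
      by (auto simp: up_def)
    have "i \<noteq> j" using that j by auto
    then consider "i \<le> j - 1" | "j \<le> i - 1" by linarith
    thus False
      using that j psum_mono[of i "j - 1" \<alpha>] psum_mono[of j "i - 1" \<alpha>] by cases linarith+
  qed
  have **: "up k" if "odd i" "psum \<alpha> (i - 1) \<le> k" "k < psum \<alpha> i" for i k
    using that by (auto simp: up_def)
  have "h x < h y" if "(x, y) \<in> fence_covers \<alpha>" for x y
  proof -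
    from that obtain k i where
      "x = k \<and> y = k + 1 \<and> odd i \<or> x = k + 1 \<and> y = k \<and> even i"
      "psum \<alpha> (i - 1) \<le> k" "k < psum \<alpha> i"
      unfolding fence_covers_def by blast
    thus ?thesis using * ** by (auto simp: h_def)
  qed
  thus ?thesis by (rule that)
qed

lemma fence_covers_subset: "fence_covers \<alpha> \<subseteq> {1..fence_size \<alpha>} \<times> {1..fence_size \<alpha>}"
  by (auto simp: fence_covers_def)

lemma Field_fence: "Field (fence \<alpha>) = {1..fence_size \<alpha>}"
proof
  show "Field (fence \<alpha>) \<subseteq> {1..fence_size \<alpha>}"
    using trancl_subset_Sigma[OF fence_covers_subset[of \<alpha>]]
    unfolding fence_def Field_def Id_on_def by blast
  show "{1..fence_size \<alpha>} \<subseteq> Field (fence \<alpha>)"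
    unfolding fence_def Field_def Id_on_def by blast
qed

lemma partial_order_on_fence: "partial_order_on (Field (fence \<alpha>)) (fence \<alpha>)"
proof -
  obtain h :: "nat \<Rightarrow> int" where h: "\<And>x y. (x, y) \<in> fence_covers \<alpha> \<Longrightarrow> h x < h y"
    using fence_covers_height[of \<alpha>] by blast
  have "h x < h y" if "(x, y) \<in> (fence_covers \<alpha>)\<^sup>+" for x y
    using that by induction (auto dest: h intro: less_trans)
  hence "x = y \<or> h x < h y" if "(x, y) \<in> fence \<alpha>" for x y
    using that unfolding fence_def by blast
  hence "antisym (fence \<alpha>)" unfolding antisym_def by (metis less_asym)
  moreover have "trans (fence \<alpha>)"
    unfolding fence_def trans_def by (auto intro: trancl_trans)
  moreover have "refl_on (Field (fence \<alpha>)) (fence \<alpha>)"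
    unfolding Field_fence by (auto simp: refl_on_def fence_def)
  ultimately show ?thesis
    unfolding partial_order_on_def preorder_on_def by (auto simp: Field_def)
qed

section \<open>Rowmotion is bijective\<close>

context
  fixes r :: "'a rel"
  assumes fin: "finite (Field r)" and po: "partial_order_on (Field r) r"
begin

lemma po_reflD: "x \<in> Field r \<Longrightarrow> (x, x) \<in> r"
  using po by (auto simp: partial_order_on_def preorder_on_def refl_on_def)

lemma po_antisymD: "(x, y) \<in> r \<Longrightarrow> (y, x) \<in> r \<Longrightarrow> x = y"
  using po by (auto simp: partial_order_on_def antisym_def)

lemma po_transD: "(x, y) \<in> r \<Longrightarrow> (y, z) \<in> r \<Longrightarrow> (x, z) \<in> r"
  using po unfolding partial_order_on_def preorder_on_def by (meson transD)

lemma minimal_below: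
  assumes "X \<subseteq> Field r" "x \<in> X"
  shows "\<exists>m\<in>minimals r X. (m, x) \<in> r"
proof -
  have "r \<subseteq> Field r \<times> Field r"
    using po by (simp add: partial_order_on_def preorder_on_def)
  hence "finite r" by (rule finite_subset) (simp add: fin)
  hence wf: "wf (r - Id)"
    using finite_acyclic_wf[OF finite_Diff partial_order_on_acyclic[OF po]] by simp
  let ?Q = "{y\<in>X. (y, x) \<in> r}"
  have "x \<in> ?Q" using assms po_reflD by auto
  then obtain m where m: "m \<in> ?Q" "\<And>y. (y, m) \<in> r - Id \<Longrightarrow> y \<notin> ?Q"
    using wfE_min[OF wf, of x ?Q] by blast
  have "y = m" if "y \<in> X" "(y, m) \<in> r" for y
    using that m po_transD[OF that(2), of x] by auto
  hence "m \<in> minimals r X" using m(1) by (auto simp: minimals_def)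
  thus ?thesis using m by blast
qed

lemma ideal_gen_ideal: "ideal_gen r A \<in> ideals r"
  unfolding ideals_def ideal_gen_def ofilter_def under_def Field_def using po_transD by blast

lemma inj_on_ideal_gen: "inj_on (ideal_gen r) (antichains r)"
proof -
  have *: "A = {x\<in>ideal_gen r A. \<forall>y\<in>ideal_gen r A. (x, y) \<in> r \<longrightarrow> x = y}"
    if A: "A \<in> antichains r" for A
  proof (intro set_eqI iffI)
    fix x assume x: "x \<in> A"
    hence "(x, x) \<in> r" using A po_reflD by (auto simp: antichains_def)
    moreover have "x = y" if "(x, y) \<in> r" "(y, a) \<in> r" "a \<in> A" for y a
      using that x A po_transD[OF that(1,2)] po_antisymD unfolding antichains_def by blast
    ultimately show "x \<in> {x\<in>ideal_gen r A. \<forall>y\<in>ideal_gen r A. (x, y) \<in> r \<longrightarrow> x = y}"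
      using x by (auto simp: ideal_gen_def under_def)
  next
    fix x assume x: "x \<in> {x\<in>ideal_gen r A. \<forall>y\<in>ideal_gen r A. (x, y) \<in> r \<longrightarrow> x = y}"
    then obtain a where a: "a \<in> A" "(x, a) \<in> r" by (auto simp: ideal_gen_def under_def)
    moreover have "a \<in> ideal_gen r A"
      using a A po_reflD by (auto simp: ideal_gen_def under_def antichains_def)
    ultimately show "x \<in> A" using x by auto
  qed
  show ?thesis by (rule inj_on_inverseI) (rule *[symmetric])
qed

lemma inj_on_minimals_compl: "inj_on (\<lambda>I. minimals r (Field r - I)) (ideals r)"
proof -
  have *: "I = {x\<in>Field r. \<not> (\<exists>m\<in>minimals r (Field r - I). (m, x) \<in> r)}"
    if I: "I \<in> ideals r" for I
  proof (intro set_eqI iffI)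
    fix x assume "x \<in> I"
    thus "x \<in> {x\<in>Field r. \<not> (\<exists>m\<in>minimals r (Field r - I). (m, x) \<in> r)}"
      using I unfolding ideals_def ofilter_def under_def minimals_def by blast
  next
    fix x assume "x \<in> {x\<in>Field r. \<not> (\<exists>m\<in>minimals r (Field r - I). (m, x) \<in> r)}"
    thus "x \<in> I" using minimal_below[of "Field r - I" x] by blast
  qed
  show ?thesis by (rule inj_on_inverseI) (rule *[symmetric])
qed

lemma minimals_antichain: "X \<subseteq> Field r \<Longrightarrow> minimals r X \<in> antichains r"
  by (auto simp: antichains_def minimals_def)

lemma bij_betw_row_antichain: "bij_betw (row_antichain r) (antichains r) (antichains r)"
proof -
  have inj: "inj_on (row_antichain r) (antichains r)"
    using comp_inj_on[OF inj_on_ideal_gen inj_on_subset[OF inj_on_minimals_compl]] ideal_gen_ideal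
    by (auto simp: row_antichain_def[abs_def] comp_def image_subset_iff)
  have fin': "finite (antichains r)"
    by (rule finite_subset[of _ "Pow (Field r)"]) (auto simp: antichains_def fin)
  have sub: "row_antichain r ` antichains r \<subseteq> antichains r"
    by (auto simp: row_antichain_def intro: minimals_antichain)
  show ?thesis
    using endo_inj_surj[OF fin' sub inj] inj by (simp add: bij_betw_def)
qed

lemma bij_betw_row_ideal: "bij_betw (row_ideal r) (ideals r) (ideals r)"
proof -
  have inj: "inj_on (row_ideal r) (ideals r)"
    using comp_inj_on[OF inj_on_minimals_compl inj_on_subset[OF inj_on_ideal_gen]]
      minimals_antichain[OF Diff_subset]
    by (auto simp: row_ideal_def[abs_def] comp_def image_subset_iff)
  have fin': "finite (ideals r)"
    by (rule finite_subset[of _ "Pow (Field r)"]) (auto simp: ideals_def ofilter_def fin)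
  have sub: "row_ideal r ` ideals r \<subseteq> ideals r"
    by (auto simp: row_ideal_def intro: ideal_gen_ideal)
  show ?thesis
    using endo_inj_surj[OF fin' sub inj] inj by (simp add: bij_betw_def)
qed

end

end

theory Submission
  imports Defs
begin

text \<open>
  Read a segment upwards as $c_0 < c_1 < \dots < c_l$ with $l = \alpha_i$, where $c_0$ and $c_l$ are
  the shared elements (possibly absent) and the others are unshared. Let $f_j$ be the number of
  ideals in an orbit that contain $c_j$. An unshared $c_j$ lies in an antichain \<open>A\<close> iff the ideal
  \<open>I\<close> generated by \<open>A\<close> contains $c_j$ but not $c_{j+1}$, and it lies in \<open>\<rho> A\<close> iff \<open>I\<close> contains
  $c_{j-1}$ but not $c_j$. Summing over an orbit \<open>\<O>\<close>, $c_j$ occurs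
  $f_j - f_{j+1} = f_{j-1} - f_j$ times, so $f_0, \dots, f_l$ is an arithmetic progression. As $c_l$ is
  maximal and $c_0$ is minimal, $f_l$ counts the antichains containing $c_l$ and
  $\#\mathcal{O} - f_0$ counts those containing $c_0$. All six parts follow from this progression.
\<close>

section \<open>Rowmotion orbits\<close>

context
  fixes r :: "'a rel"
  assumes fin: "finite (Field r)" and po: "partial_order_on (Field r) r"
begin

lemma row_antichain_closed: "A \<in> antichains r \<Longrightarrow> row_antichain r A \<in> antichains r"
  using bij_betwE[OF bij_betw_row_antichain[OF fin po]] by blast

lemma antichain_orbit_subset:
  assumes "A \<in> antichains r"
  shows "orbit (row_antichain r) A \<subseteq> antichains r"
proof
  fix B assume "B \<in> orbit (row_antichain r) A"
  thus "B \<in> antichains r" by induction (auto intro: row_antichain_closed assms)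
qed

lemma finite_antichain_orbit:
  assumes "A \<in> antichains r"
  shows "finite (orbit (row_antichain r) A)"
proof (rule finite_subset)
  show "orbit (row_antichain r) A \<subseteq> Pow (Field r)"
    using antichain_orbit_subset[OF assms] by (auto simp: antichains_def)
qed (simp add: fin)

lemma card_antichain_orbit_pos: "A \<in> antichains r \<Longrightarrow> 0 < card (orbit (row_antichain r) A)"
  using finite_antichain_orbit orbit.base[of "row_antichain r" A] card_gt_0_iff by blast

text \<open>Rowmotion permutes each of its orbits, so counting an element in the antichains and
  counting it in their images give the same total.\<close>

lemma sum_antichain_orbit_shift:
  assumes "A \<in> antichains r"
  shows "(\<Sum>B\<in>orbit (row_antichain r) A. g (row_antichain r B)) =
    (\<Sum>B\<in>orbit (row_antichain r) A. g B)"
proof (rule sum.reindex_bij_betw)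
  let ?O = "orbit (row_antichain r) A"
  have "inj_on (row_antichain r) ?O"
    using bij_betw_row_antichain[OF fin po] antichain_orbit_subset[OF assms]
    by (meson bij_betw_def inj_on_subset)
  thus "bij_betw (row_antichain r) ?O ?O"
    using endo_inj_surj[OF finite_antichain_orbit[OF assms]] orbit.step[of _ "row_antichain r" A]
    by (simp add: bij_betw_def image_subset_iff)
qed

text \<open>Orbits are finite and nonempty, so the denominator can be cleared and each claim becomes
  an identity of orbit sums.\<close>

lemma mesic_antichain_orbits_iff:
  "mesic (antichain_orbits r) st d \<longleftrightarrow>
    (\<forall>A\<in>antichains r. (\<Sum>B\<in>orbit (row_antichain r) A. st B) =
      d * real (card (orbit (row_antichain r) A)))"
  unfolding mesic_def antichain_orbits_def
  using card_antichain_orbit_pos by (auto simp: field_simps)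

section \<open>Transfer between antichain orbits and ideal orbits\<close>

lemma row_ideal_ideal_gen: "row_ideal r (ideal_gen r A) = ideal_gen r (row_antichain r A)"
  by (simp add: row_ideal_def row_antichain_def)

lemma orbit_row_ideal:
  "orbit (row_ideal r) (ideal_gen r A) = ideal_gen r ` orbit (row_antichain r) A"
proof (intro equalityI subsetI)
  fix J assume "J \<in> orbit (row_ideal r) (ideal_gen r A)"
  thus "J \<in> ideal_gen r ` orbit (row_antichain r) A"
    by induction (auto simp: row_ideal_ideal_gen intro: orbit.intros)
next
  fix J assume "J \<in> ideal_gen r ` orbit (row_antichain r) A"
  then obtain B where "B \<in> orbit (row_antichain r) A" and J: "J = ideal_gen r B" by blast
  from this(1) have "ideal_gen r B \<in> orbit (row_ideal r) (ideal_gen r A)"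
    by induction (auto simp flip: row_ideal_ideal_gen intro: orbit.intros)
  thus "J \<in> orbit (row_ideal r) (ideal_gen r A)" by (simp add: J)
qed

text \<open>Every ideal is a value of \<open>row_ideal\<close> by surjectivity, and such a value is
  by construction generated by an antichain of minimal elements.\<close>

lemma ideals_eq_ideal_gen: "ideals r = ideal_gen r ` antichains r"
proof
  show "ideals r \<subseteq> ideal_gen r ` antichains r"
  proof
    fix I assume "I \<in> ideals r"
    then obtain J where "I = row_ideal r J"
      using bij_betw_row_ideal[OF fin po] by (auto simp: bij_betw_def)
    thus "I \<in> ideal_gen r ` antichains r"
      using minimals_antichain[OF fin po, of "Field r - J"] by (auto simp: row_ideal_def)
  qed
qed (use ideal_gen_ideal[OF fin po] in auto)

lemma ideal_orbits_eq: "ideal_orbits r = (`) (ideal_gen r) ` antichain_orbits r"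
  by (simp add: ideal_orbits_def antichain_orbits_def ideals_eq_ideal_gen image_image
      orbit_row_ideal)

lemma inj_on_ideal_gen_orbit:
  "A \<in> antichains r \<Longrightarrow> inj_on (ideal_gen r) (orbit (row_antichain r) A)"
  using inj_on_ideal_gen[OF fin po] antichain_orbit_subset by (meson inj_on_subset)

text \<open>\<open>ideal_gen\<close> is injective on an orbit, so sums over ideals pull back to
  antichains with the same orbit size.\<close>

lemma mesic_ideal_orbits_iff:
  "mesic (ideal_orbits r) st d \<longleftrightarrow>
    mesic (antichain_orbits r) (\<lambda>A. st (ideal_gen r A)) d"
  unfolding mesic_def ideal_orbits_eq ball_simps antichain_orbits_def
  using inj_on_ideal_gen_orbit by (simp add: sum.reindex card_image)

section \<open>Local criteria for membership in an antichain and in its image\<close>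

lemma mem_ideal_gen_iff: "x \<in> ideal_gen r A \<longleftrightarrow> (\<exists>a\<in>A. (x, a) \<in> r)"
  by (auto simp: ideal_gen_def under_def)

text \<open>The hypothesis \<open>up\<close> says that \<open>y\<close> is the only upper cover of
  \<open>x\<close> or, if \<open>y\<close> is outside \<open>Field r\<close>, that \<open>x\<close>
  is maximal. An element of \<open>A\<close> above \<open>x\<close> is then \<open>x\<close> itself
  or lies above \<open>y\<close>.\<close>

lemma antichain_mem_iff_ideal_gen:
  assumes "A \<in> antichains r" "x \<in> Field r" "y \<noteq> x"
    and up: "\<And>z. (x, z) \<in> r \<longleftrightarrow> z = x \<or> (y, z) \<in> r"
  shows "x \<in> A \<longleftrightarrow> x \<in> ideal_gen r A \<and> y \<notin> ideal_gen r A"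
proof -
  have "(y, x) \<notin> r"
  proof
    assume yx: "(y, x) \<in> r"
    hence "(y, y) \<in> r" by (intro po_reflD[OF fin po]) (auto simp: Field_def)
    hence "(x, y) \<in> r" using up by blast
    thus False using yx assms(3) po_antisymD[OF fin po] by blast
  qed
  moreover have "a = x" if "x \<in> A" "a \<in> A" "(x, a) \<in> r" for a
    using assms(1) that by (auto simp: antichains_def)
  moreover have "(x, x) \<in> r" using assms(2) po_reflD[OF fin po] by blast
  ultimately show ?thesis unfolding mem_ideal_gen_iff by (metis up)
qed

lemma maximal_mem_iff_ideal_gen:
  assumes "A \<in> antichains r" and "\<And>z. (x, z) \<in> r \<Longrightarrow> z = x"
  shows "x \<in> A \<longleftrightarrow> x \<in> ideal_gen r A"
  using assms po_reflD[OF fin po, of x]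
  by (auto simp: mem_ideal_gen_iff antichains_def)

lemma row_antichain_mem_iff:
  "x \<in> row_antichain r A \<longleftrightarrow>
    x \<in> Field r \<and> x \<notin> ideal_gen r A \<and> (\<forall>z. (z, x) \<in> r \<longrightarrow> z = x \<or> z \<in> ideal_gen r A)"
  by (auto simp: row_antichain_def minimals_def Field_def)

text \<open>Here \<open>y\<close> is the only lower cover of \<open>x\<close>, so \<open>x\<close>
  is minimal outside the ideal exactly when \<open>y\<close> is inside and \<open>x\<close> is
  not.\<close>

lemma row_antichain_mem_iff_ideal_gen:
  assumes "x \<in> Field r" "y \<in> Field r" "y \<noteq> x"
    and down: "\<And>z. (z, x) \<in> r \<longleftrightarrow> z = x \<or> (z, y) \<in> r"
  shows "x \<in> row_antichain r A \<longleftrightarrow> y \<in> ideal_gen r A \<and> x \<notin> ideal_gen r A"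
proof -
  have "(y, y) \<in> r" using assms po_reflD[OF fin po] by blast
  moreover have "(x, x) \<in> r" using assms po_reflD[OF fin po] by blast
  ultimately show ?thesis
    using assms po_transD[OF fin po] unfolding row_antichain_mem_iff mem_ideal_gen_iff by metis
qed

lemma row_antichain_minimal_mem_iff:
  assumes "x \<in> Field r" "\<And>z. (z, x) \<in> r \<Longrightarrow> z = x"
  shows "x \<in> row_antichain r A \<longleftrightarrow> x \<notin> ideal_gen r A"
  using assms by (auto simp: row_antichain_mem_iff)

end

section \<open>Segments of a poset\<close>

text \<open>An absent shared element is represented by a \<open>c 0\<close> or \<open>c l\<close> outside of \<open>Field r\<close>.\<close>

definition poset_segment :: "'a rel \<Rightarrow> (nat \<Rightarrow> 'a) \<Rightarrow> nat \<Rightarrow> bool" where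
  "poset_segment r c l \<longleftrightarrow>
     inj_on c {..l} \<and> c ` {0<..<l} \<subseteq> Field r \<and>
     (\<forall>j\<in>{0<..<l}. \<forall>z. (c j, z) \<in> r \<longleftrightarrow> z = c j \<or> (c (Suc j), z) \<in> r) \<and>
     (\<forall>j\<in>{0<..<l}. \<forall>z. (z, c j) \<in> r \<longleftrightarrow> z = c j \<or> (z, c (j - 1)) \<in> r) \<and>
     (\<forall>z. (c l, z) \<in> r \<longrightarrow> z = c l) \<and> (\<forall>z. (z, c 0) \<in> r \<longrightarrow> z = c 0)"

text \<open>An absent bottom element counts as a member of every ideal.\<close>

definition segment_chi :: "'a rel \<Rightarrow> (nat \<Rightarrow> 'a) \<Rightarrow> nat \<Rightarrow> 'a set \<Rightarrow> real" where
  "segment_chi r c j I = (if j = 0 \<and> c 0 \<notin> Field r then 1 else chi (c j) I)"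

context
  fixes r :: "'a rel" and c :: "nat \<Rightarrow> 'a" and l :: nat
  assumes fin: "finite (Field r)" and po: "partial_order_on (Field r) r"
    and seg: "poset_segment r c l"
begin

lemma segment_neq: "i \<le> l \<Longrightarrow> j \<le> l \<Longrightarrow> i \<noteq> j \<Longrightarrow> c i \<noteq> c j"
  using seg by (auto simp: poset_segment_def inj_on_def)

text \<open>An ideal containing \<open>c (Suc j)\<close> contains \<open>c j\<close>, so the
  difference of the indicators is again an indicator.\<close>

lemma chi_antichain_segment:
  assumes A: "A \<in> antichains r" and j: "0 < j" "j < l"
  shows "chi (c j) A =
    segment_chi r c j (ideal_gen r A) - segment_chi r c (Suc j) (ideal_gen r A)"
proof -
  have up: "\<And>z. (c j, z) \<in> r \<longleftrightarrow> z = c j \<or> (c (Suc j), z) \<in> r" and x: "c j \<in> Field r"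
    using seg j by (auto simp: poset_segment_def)
  have "c j \<in> A \<longleftrightarrow> c j \<in> ideal_gen r A \<and> c (Suc j) \<notin> ideal_gen r A"
    using j by (intro antichain_mem_iff_ideal_gen[OF fin po A x _ up] segment_neq) auto
  moreover have "c j \<in> ideal_gen r A" if "c (Suc j) \<in> ideal_gen r A"
    using that up unfolding mem_ideal_gen_iff[OF fin po] by meson
  ultimately show ?thesis using j by (auto simp: segment_chi_def chi_def indicator_def)
qed

lemma chi_row_antichain_segment:
  assumes A: "A \<in> antichains r" and j: "0 < j" "j < l"
  shows "chi (c j) (row_antichain r A) =
    segment_chi r c (j - 1) (ideal_gen r A) - segment_chi r c j (ideal_gen r A)"
proof -
  have down: "\<And>z. (z, c j) \<in> r \<longleftrightarrow> z = c j \<or> (z, c (j - 1)) \<in> r" and x: "c j \<in> Field r"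
    using seg j by (auto simp: poset_segment_def)
  show ?thesis
  proof (cases "c (j - 1) \<in> Field r")
    case True
    have mem: "c j \<in> row_antichain r A \<longleftrightarrow>
        c (j - 1) \<in> ideal_gen r A \<and> c j \<notin> ideal_gen r A"
      using j by (intro row_antichain_mem_iff_ideal_gen[OF fin po x True _ down] segment_neq) auto
    have "(c (j - 1), c j) \<in> r" using down po_reflD[OF fin po True] by blast
    hence "c (j - 1) \<in> ideal_gen r A" if "c j \<in> ideal_gen r A"
      using that po_transD[OF fin po] unfolding mem_ideal_gen_iff[OF fin po] by meson
    with True mem j show ?thesis by (auto simp: segment_chi_def chi_def indicator_def)
  next
    case False
    \<comment> \<open>Below an inner element only the bottom of the segment can be absent. Then
      \<open>c 1\<close> is minimal, and the default value 1 of \<open>segment_chi\<close> at 0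
      preserves the formula.\<close>
    hence "\<not> j - 1 \<in> {0<..<l}" using seg by (auto simp: poset_segment_def image_subset_iff)
    hence "j = 1" using j by auto
    moreover have "c j \<in> row_antichain r A \<longleftrightarrow> c j \<notin> ideal_gen r A"
    proof (rule row_antichain_minimal_mem_iff[OF fin po x])
      fix z assume "(z, c j) \<in> r"
      thus "z = c j" using False by (subst (asm) down) (auto simp: Field_def)
    qed
    ultimately show ?thesis using False by (auto simp: segment_chi_def chi_def indicator_def)
  qed
qed

text \<open>Maximality turns membership in the generated ideal into membership in \<open>A\<close>.
  The bound \<open>0 < l\<close> keeps index \<open>l\<close> away from the default value of
  \<open>segment_chi\<close>; an absent top gives 0 on both sides.\<close>

lemma chi_antichain_segment_top:
  assumes "A \<in> antichains r" "0 < l"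
  shows "chi (c l) A = segment_chi r c l (ideal_gen r A)"
proof -
  have "\<And>z. (c l, z) \<in> r \<Longrightarrow> z = c l" using seg by (auto simp: poset_segment_def)
  from maximal_mem_iff_ideal_gen[OF fin po assms(1) this] show ?thesis
    using assms(2) by (auto simp: segment_chi_def chi_def indicator_def)
qed

text \<open>A minimal element enters the next antichain exactly when the ideal misses it. For an
  absent bottom the default value 1 makes both sides 0.\<close>

lemma chi_row_antichain_segment_bottom:
  assumes A: "A \<in> antichains r"
  shows "chi (c 0) (row_antichain r A) = 1 - segment_chi r c 0 (ideal_gen r A)"
proof (cases "c 0 \<in> Field r")
  case True
  have "\<And>z. (z, c 0) \<in> r \<Longrightarrow> z = c 0" using seg by (auto simp: poset_segment_def)
  from row_antichain_minimal_mem_iff[OF fin po True this] True show ?thesis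
    by (auto simp: segment_chi_def chi_def indicator_def)
next
  case False
  hence "c 0 \<notin> row_antichain r A"
    using row_antichain_mem_iff[OF fin po] by blast
  with False show ?thesis by (auto simp: segment_chi_def chi_def indicator_def)
qed

text \<open>This is the arithmetic progression f_0, ..., f_l in closed form. The bound
  \<open>2 \<le> l\<close> makes \<open>c 1\<close> an inner element, whose count is the common
  decrement.\<close>

lemma sum_segment_chi:
  fixes A defines "\<O> \<equiv> orbit (row_antichain r) A"
  assumes A: "A \<in> antichains r" and l: "2 \<le> l" and "j \<le> l"
  shows "(\<Sum>B\<in>\<O>. segment_chi r c j (ideal_gen r B)) =
    real (card \<O>) - (\<Sum>B\<in>\<O>. chi (c 0) B) - real j * (\<Sum>B\<in>\<O>. chi (c 1) B)"
  using \<open>j \<le> l\<close>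
proof (induction j rule: less_induct)
  case (less j)
  have anti: "B \<in> antichains r" if "B \<in> \<O>" for B
    using that antichain_orbit_subset[OF fin po A] by (auto simp: \<O>_def)
  note shift = sum_antichain_orbit_shift[OF fin po A, folded \<O>_def]
  let ?f = "\<lambda>j. \<Sum>B\<in>\<O>. segment_chi r c j (ideal_gen r B)"
  have row: "(\<Sum>B\<in>\<O>. chi (c k) B) = ?f (k - 1) - ?f k" if "0 < k" "k < l" for k
    using shift[of "chi (c k)"] chi_row_antichain_segment[OF anti that]
    by (simp add: sum_subtractf)
  have col: "(\<Sum>B\<in>\<O>. chi (c k) B) = ?f k - ?f (Suc k)" if "0 < k" "k < l" for k
    using chi_antichain_segment[OF anti that] by (simp add: sum_subtractf)
  have zero: "?f 0 = real (card \<O>) - (\<Sum>B\<in>\<O>. chi (c 0) B)"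
    using shift[of "chi (c 0)"] chi_row_antichain_segment_bottom[OF anti]
    by (simp add: sum_subtractf)
  consider "j = 0" | "j = 1" | i where "j = Suc (Suc i)"
    by (metis One_nat_def old.nat.exhaust)
  thus ?case
  proof cases
    \<comment> \<open>\<open>row\<close> and \<open>col\<close> at \<open>Suc i\<close> give f_i -
      f_(i+1) = f_(i+1) - f_(i+2); two earlier terms enter, hence the strong induction.\<close>
    case 3
    thus ?thesis
      using less.IH[of i] less.IH[of "Suc i"] less.prems row[of "Suc i"] col[of "Suc i"]
      by (auto simp: algebra_simps)
  qed (use zero row[of 1] l in \<open>auto\<close>)
qed

end

section \<open>Segments of a fence\<close>

lemma finite_Field_fence: "finite (Field (fence \<alpha>))"
  by (simp add: Field_fence)

section \<open>Partial sums and covering relations\<close>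

lemma psum_0 [simp]: "psum \<alpha> 0 = 0"
  by (simp add: psum_def)

lemma psum_Suc: "i < length \<alpha> \<Longrightarrow> psum \<alpha> (Suc i) = psum \<alpha> i + \<alpha> ! i"
  by (simp add: psum_def take_Suc_conv_app_nth)

text \<open>The segment index in \<open>fence_covers\<close> is bound existentially. Disjointness of
  the half-open intervals shows that \<open>k\<close> determines it, and with it the direction of
  the step at \<open>k\<close>.\<close>

lemma psum_interval_unique:
  assumes "psum \<alpha> (i - 1) \<le> k" "k < psum \<alpha> i" "psum \<alpha> (j - 1) \<le> k" "k < psum \<alpha> j"
  shows "i = j"
proof (rule ccontr)
  assume "i \<noteq> j"
  then consider "i \<le> j - 1" | "j \<le> i - 1" by linarith
  thus False
    using assms psum_mono[of i "j - 1" \<alpha>] psum_mono[of j "i - 1" \<alpha>] by cases linarith+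
qed

text \<open>Splitting off the first covering step describes what lies above \<open>x\<close> through
  its upper covers, which reduces \<open>poset_segment\<close> to a study of covers.\<close>

lemma fence_up_iff:
  "(x, z) \<in> fence \<alpha> \<longleftrightarrow>
    x = z \<and> x \<in> {1..fence_size \<alpha>} \<or> (\<exists>y. (x, y) \<in> fence_covers \<alpha> \<and> (y, z) \<in> fence \<alpha>)"
proof -
  have "(x, z) \<in> (fence_covers \<alpha>)\<^sup>+ \<longleftrightarrow>
      (\<exists>y. (x, y) \<in> fence_covers \<alpha> \<and> (y = z \<or> (y, z) \<in> (fence_covers \<alpha>)\<^sup>+))"
    by (metis converse_tranclE r_into_trancl trancl_into_trancl2)
  thus ?thesis using fence_covers_subset[of \<alpha>] unfolding fence_def by blast
qed

lemma fence_down_iff: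
  "(z, x) \<in> fence \<alpha> \<longleftrightarrow>
    x = z \<and> x \<in> {1..fence_size \<alpha>} \<or> (\<exists>y. (y, x) \<in> fence_covers \<alpha> \<and> (z, y) \<in> fence \<alpha>)"
proof -
  have "(z, x) \<in> (fence_covers \<alpha>)\<^sup>+ \<longleftrightarrow>
      (\<exists>y. (y, x) \<in> fence_covers \<alpha> \<and> (y = z \<or> (z, y) \<in> (fence_covers \<alpha>)\<^sup>+))"
    by (metis tranclE r_into_trancl trancl_into_trancl)
  thus ?thesis using fence_covers_subset[of \<alpha>] unfolding fence_def by blast
qed

lemma fence_covers_adjacent: "(x, y) \<in> fence_covers \<alpha> \<Longrightarrow> y = Suc x \<or> x = Suc y"
  by (auto simp: fence_covers_def)

lemma fence_covers_Suc_iff: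
  assumes "i \<in> {1..length \<alpha>}" "psum \<alpha> (i - 1) \<le> k" "k < psum \<alpha> i"
  shows "(k, Suc k) \<in> fence_covers \<alpha> \<longleftrightarrow> 1 \<le> k \<and> k < fence_size \<alpha> \<and> odd i"
    and "(Suc k, k) \<in> fence_covers \<alpha> \<longleftrightarrow> 1 \<le> k \<and> k < fence_size \<alpha> \<and> even i"
proof -
  have "j = i" if "psum \<alpha> (j - 1) \<le> k" "k < psum \<alpha> j" for j
    using psum_interval_unique assms(2,3) that by blast
  hence *: "(\<exists>j. j \<in> {1..length \<alpha>} \<and> psum \<alpha> (j - 1) \<le> k \<and> k < psum \<alpha> j \<and> P j) \<longleftrightarrow> P i" for P
    using assms by blast
  show "(k, Suc k) \<in> fence_covers \<alpha> \<longleftrightarrow> 1 \<le> k \<and> k < fence_size \<alpha> \<and> odd i"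
    using *[of odd] by (auto simp: fence_covers_def)
  show "(Suc k, k) \<in> fence_covers \<alpha> \<longleftrightarrow> 1 \<le> k \<and> k < fence_size \<alpha> \<and> even i"
    using *[of even] by (auto simp: fence_covers_def)
qed

text \<open>Segments with even index descend along the fence, so they are read backwards.\<close>

definition fence_chain :: "nat list \<Rightarrow> nat \<Rightarrow> nat \<Rightarrow> nat" where
  "fence_chain \<alpha> i j = (if odd i then psum \<alpha> (i - 1) + j else psum \<alpha> i - j)"

context
  fixes \<alpha> :: "nat list"
  assumes comp: "fence_composition \<alpha>"
begin

lemma part_pos: "i < length \<alpha> \<Longrightarrow> 0 < \<alpha> ! i"
  using comp by (auto simp: fence_composition_def)

lemma psum_pred:
  "i \<in> {1..length \<alpha>} \<Longrightarrow> psum \<alpha> i = psum \<alpha> (i - 1) + \<alpha> ! (i - 1)"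
  using psum_Suc[of "i - 1" \<alpha>] by auto

lemma psum_pred_less: "i \<in> {1..length \<alpha>} \<Longrightarrow> psum \<alpha> (i - 1) < psum \<alpha> i"
  using psum_pred[of i] part_pos[of "i - 1"] by auto

text \<open>The last partial sum is positive, so the subtraction in \<open>fence_size\<close> is not
  truncated. The number n + 1 lies just outside the fence and stands for the absent end of the last
  segment, as 0 does for the first.\<close>

lemma Suc_fence_size: "Suc (fence_size \<alpha>) = psum \<alpha> (length \<alpha>)"
proof -
  have "length \<alpha> \<in> {1..length \<alpha>}" using comp by (auto simp: fence_composition_def Suc_le_eq)
  from psum_pred_less[OF this] show ?thesis by (simp add: fence_size_def)
qed

lemma psum_in_fence_imp:
  assumes "psum \<alpha> i \<in> {1..fence_size \<alpha>}"
  shows "i \<in> {1..length \<alpha>}" "Suc i \<in> {1..length \<alpha>}"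
proof -
  have "i \<noteq> 0" using assms by (cases i) auto
  moreover have "i < length \<alpha>"
    using assms psum_mono[of "length \<alpha>" i \<alpha>] Suc_fence_size by fastforce
  ultimately show "i \<in> {1..length \<alpha>}" "Suc i \<in> {1..length \<alpha>}" by auto
qed

text \<open>An endpoint inside the fence also belongs to the neighbouring segment, and an endpoint
  outside belongs to none.\<close>

lemma unshared_eq:
  assumes i: "i \<in> {1..length \<alpha>}"
  shows "unshared \<alpha> i = {psum \<alpha> (i - 1)<..<psum \<alpha> i}"
proof (intro equalityI subsetI)
  fix k assume k: "k \<in> unshared \<alpha> i"
  hence bounds: "k \<in> {1..fence_size \<alpha>}" "psum \<alpha> (i - 1) \<le> k" "k \<le> psum \<alpha> i"
    and other: "\<And>j. j \<in> {1..length \<alpha>} \<Longrightarrow> j \<noteq> i \<Longrightarrow> k \<notin> segment \<alpha> j"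
    by (auto simp: unshared_def segment_def)
  have "k \<noteq> psum \<alpha> (i - 1)"
  proof
    assume eq: "k = psum \<alpha> (i - 1)"
    hence "i - 1 \<in> {1..length \<alpha>}" using psum_in_fence_imp(1) bounds by blast
    moreover have "psum \<alpha> (i - 1 - 1) \<le> k" using psum_mono[of "i - 1 - 1" "i - 1"] eq by simp
    moreover have "i - 1 \<noteq> i" using i by auto
    ultimately show False using other[of "i - 1"] bounds eq by (simp add: segment_def)
  qed
  moreover have "k \<noteq> psum \<alpha> i"
  proof
    assume eq: "k = psum \<alpha> i"
    hence "Suc i \<in> {1..length \<alpha>}" using psum_in_fence_imp(2) bounds by blast
    moreover have "k \<le> psum \<alpha> (Suc i)" using psum_mono[of i "Suc i"] eq by simp
    ultimately show False using other[of "Suc i"] bounds eq by (auto simp: segment_def)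
  qed
  ultimately show "k \<in> {psum \<alpha> (i - 1)<..<psum \<alpha> i}" using bounds by auto
next
  fix k assume k: "k \<in> {psum \<alpha> (i - 1)<..<psum \<alpha> i}"
  have "k \<notin> segment \<alpha> j" if "j \<noteq> i" for j
  proof -
    from that consider "j \<le> i - 1" | "i \<le> j - 1" by linarith
    thus ?thesis using k psum_mono[of j "i - 1" \<alpha>] psum_mono[of i "j - 1" \<alpha>]
      by cases (auto simp: segment_def)
  qed
  moreover have "k \<in> segment \<alpha> i"
    using k i psum_mono[of i "length \<alpha>" \<alpha>] Suc_fence_size by (auto simp: segment_def)
  ultimately show "k \<in> unshared \<alpha> i" by (auto simp: unshared_def)
qed

lemma unshared_subset_fence: "unshared \<alpha> i \<subseteq> {1..fence_size \<alpha>}"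
  by (auto simp: unshared_def segment_def)

text \<open>Both steps at an inner point of a segment go in the same direction, leaving one
  candidate for an upper and one for a lower cover. The range condition on \<open>y\<close> discards
  the candidates 0 and n + 1.\<close>

lemma unshared_covers_iff:
  assumes i: "i \<in> {1..length \<alpha>}" and k: "k \<in> unshared \<alpha> i"
  shows "(k, y) \<in> fence_covers \<alpha> \<longleftrightarrow>
      y \<in> {1..fence_size \<alpha>} \<and> y = (if odd i then Suc k else k - 1)"
    and "(y, k) \<in> fence_covers \<alpha> \<longleftrightarrow>
      y \<in> {1..fence_size \<alpha>} \<and> y = (if odd i then k - 1 else Suc k)"
proof -
  from k have b: "psum \<alpha> (i - 1) < k" "k < psum \<alpha> i" "k \<in> {1..fence_size \<alpha>}"
    using unshared_eq[OF i] subsetD[OF unshared_subset_fence k] by auto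
  then obtain m where m: "k = Suc m" by (cases k) auto
  note next_step = fence_covers_Suc_iff[OF i less_imp_le[OF b(1)] b(2)]
  have prev_step: "(m, Suc m) \<in> fence_covers \<alpha> \<longleftrightarrow> 1 \<le> m \<and> m < fence_size \<alpha> \<and> odd i"
    "(Suc m, m) \<in> fence_covers \<alpha> \<longleftrightarrow> 1 \<le> m \<and> m < fence_size \<alpha> \<and> even i"
    using fence_covers_Suc_iff[OF i, of m] b m by auto
  show "(k, y) \<in> fence_covers \<alpha> \<longleftrightarrow>
      y \<in> {1..fence_size \<alpha>} \<and> y = (if odd i then Suc k else k - 1)"
    using fence_covers_adjacent[of k y \<alpha>] next_step prev_step b m by auto
  show "(y, k) \<in> fence_covers \<alpha> \<longleftrightarrow>
      y \<in> {1..fence_size \<alpha>} \<and> y = (if odd i then k - 1 else Suc k)"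
    using fence_covers_adjacent[of y k \<alpha>] next_step prev_step b m by auto
qed

text \<open>The steps before and after p_i lie in segments \<open>i\<close> and \<open>Suc i\<close>
  of opposite parity, so p_i is a peak for odd \<open>i\<close> and a valley for even
  \<open>i\<close>.\<close>

lemma shared_no_cover:
  assumes "psum \<alpha> i \<in> {1..fence_size \<alpha>}"
  shows "odd i \<Longrightarrow> (psum \<alpha> i, y) \<notin> fence_covers \<alpha>"
    and "even i \<Longrightarrow> (y, psum \<alpha> i) \<notin> fence_covers \<alpha>"
proof -
  note i = psum_in_fence_imp[OF assms]
  from assms obtain m where m: "psum \<alpha> i = Suc m" by (cases "psum \<alpha> i") auto
  have next_step: "(psum \<alpha> i, Suc (psum \<alpha> i)) \<in> fence_covers \<alpha> \<Longrightarrow> even i"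
    "(Suc (psum \<alpha> i), psum \<alpha> i) \<in> fence_covers \<alpha> \<Longrightarrow> odd i"
    using fence_covers_Suc_iff[OF i(2), of "psum \<alpha> i"] psum_pred_less[OF i(2)] by auto
  have prev_step: "(m, Suc m) \<in> fence_covers \<alpha> \<Longrightarrow> odd i"
    "(Suc m, m) \<in> fence_covers \<alpha> \<Longrightarrow> even i"
    using fence_covers_Suc_iff[OF i(1), of m] psum_pred_less[OF i(1)] m by auto
  show "odd i \<Longrightarrow> (psum \<alpha> i, y) \<notin> fence_covers \<alpha>"
    using fence_covers_adjacent[of "psum \<alpha> i" y \<alpha>] next_step prev_step m by auto
  show "even i \<Longrightarrow> (y, psum \<alpha> i) \<notin> fence_covers \<alpha>"
    using fence_covers_adjacent[of y "psum \<alpha> i" \<alpha>] next_step prev_step m by auto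
qed

text \<open>Absent ends are included: a partial sum outside the fence occurs in no pair of the
  order.\<close>

lemma shared_maximal: "odd i \<Longrightarrow> (psum \<alpha> i, z) \<in> fence \<alpha> \<Longrightarrow> z = psum \<alpha> i"
  using shared_no_cover(1)[of i] fence_covers_subset[of \<alpha>]
  by (subst (asm) fence_up_iff) blast

lemma shared_minimal: "even i \<Longrightarrow> (z, psum \<alpha> i) \<in> fence \<alpha> \<Longrightarrow> z = psum \<alpha> i"
  using shared_no_cover(2)[of i] fence_covers_subset[of \<alpha>]
  by (subst (asm) fence_down_iff) blast

section \<open>Fence segments as chains\<close>

lemma fence_chain_params:
  assumes "i \<in> {1..length \<alpha>}"
  obtains b l where "psum \<alpha> (i - 1) = b" "\<alpha> ! (i - 1) = l" "psum \<alpha> i = b + l"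
    "\<And>j. fence_chain \<alpha> i j = (if odd i then b + j else b + l - j)"
  using psum_pred[OF assms] by (simp add: fence_chain_def)

lemma fence_chain_unshared:
  assumes i: "i \<in> {1..length \<alpha>}"
  shows "fence_chain \<alpha> i ` {0<..<\<alpha> ! (i - 1)} = unshared \<alpha> i"
proof -
  obtain b l where p: "psum \<alpha> (i - 1) = b" "\<alpha> ! (i - 1) = l" "psum \<alpha> i = b + l"
    "\<And>j. fence_chain \<alpha> i j = (if odd i then b + j else b + l - j)"
    using fence_chain_params[OF i] by blast
  show ?thesis
  proof (intro equalityI subsetI)
    fix x assume "x \<in> fence_chain \<alpha> i ` {0<..<\<alpha> ! (i - 1)}"
    then obtain j where "x = fence_chain \<alpha> i j" "0 < j" "j < l" unfolding p(2) by auto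
    thus "x \<in> unshared \<alpha> i" unfolding unshared_eq[OF i] p by auto
  next
    fix x assume x: "x \<in> unshared \<alpha> i"
    define j where "j = (if odd i then x - b else b + l - x)"
    have "x = fence_chain \<alpha> i j" "j \<in> {0<..<\<alpha> ! (i - 1)}"
      using x unfolding unshared_eq[OF i] p by (auto simp: j_def)
    thus "x \<in> fence_chain \<alpha> i ` {0<..<\<alpha> ! (i - 1)}" by blast
  qed
qed

lemma poset_segment_fence:
  assumes i: "i \<in> {1..length \<alpha>}"
  shows "poset_segment (fence \<alpha>) (fence_chain \<alpha> i) (\<alpha> ! (i - 1))"
proof -
  let ?c = "fence_chain \<alpha> i" and ?l = "\<alpha> ! (i - 1)"
  obtain b l where p: "psum \<alpha> (i - 1) = b" "?l = l" "psum \<alpha> i = b + l"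
    "\<And>j. ?c j = (if odd i then b + j else b + l - j)"
    using fence_chain_params[OF i] by blast
  have unshared: "?c j \<in> unshared \<alpha> i" if "j \<in> {0<..<?l}" for j
    using that fence_chain_unshared[OF i] by blast
  \<comment> \<open>One position up the chain is one index to the right in odd segments and one to
    the left in even ones.\<close>
  have step: "?c (Suc j) = (if odd i then Suc (?c j) else ?c j - 1)"
    "?c (j - 1) = (if odd i then ?c j - 1 else Suc (?c j))" if "j \<in> {0<..<?l}" for j
    using that unfolding p by auto
  have fence_Field: "x \<in> {1..fence_size \<alpha>} \<and> y \<in> {1..fence_size \<alpha>}"
    if "(x, y) \<in> fence \<alpha>" for x y
    using that Field_fence[of \<alpha>] by (auto simp: Field_def)
  have up: "(?c j, z) \<in> fence \<alpha> \<longleftrightarrow> z = ?c j \<or> (?c (Suc j), z) \<in> fence \<alpha>"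
    if j: "j \<in> {0<..<?l}" for j z
    unfolding fence_up_iff[of "?c j" z]
      unshared_covers_iff(1)[OF i unshared[OF j], folded step[OF j]]
    using subsetD[OF unshared_subset_fence unshared[OF j]] fence_Field[of "?c (Suc j)" z] by blast
  have down: "(z, ?c j) \<in> fence \<alpha> \<longleftrightarrow> z = ?c j \<or> (z, ?c (j - 1)) \<in> fence \<alpha>"
    if j: "j \<in> {0<..<?l}" for j z
    unfolding fence_down_iff[of z "?c j"]
      unshared_covers_iff(2)[OF i unshared[OF j], folded step[OF j]]
    using subsetD[OF unshared_subset_fence unshared[OF j]] fence_Field[of z "?c (j - 1)"] by blast
  \<comment> \<open>Consecutive partial sums have indices of opposite parity: the odd one is the top
    of the segment, the even one the bottom.\<close>
  have "?c ?l = psum \<alpha> (if odd i then i else i - 1)" "?c 0 = psum \<alpha> (if odd i then i - 1 else i)"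
    using psum_pred[OF i] by (auto simp: fence_chain_def)
  hence "(?c ?l, z) \<in> fence \<alpha> \<longrightarrow> z = ?c ?l" "(z, ?c 0) \<in> fence \<alpha> \<longrightarrow> z = ?c 0" for z
    using i shared_maximal[of i] shared_maximal[of "i - 1"]
      shared_minimal[of i] shared_minimal[of "i - 1"] by auto
  moreover have "inj_on ?c {..?l}"
    unfolding p by (auto simp: inj_on_def)
  ultimately show ?thesis
    unfolding poset_segment_def Field_fence fence_chain_unshared[OF i]
    using up down unshared_subset_fence by blast
qed

text \<open>The convention of value 0 costs nothing, as p_0 = 0 and p_s = n + 1 are not elements of
  the fence.\<close>

lemma chi_shared_eq:
  assumes "A \<subseteq> {1..fence_size \<alpha>}" "i \<le> length \<alpha>"
  shows "chi_shared \<alpha> i A = chi (psum \<alpha> i) A"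
proof (cases "1 \<le> i \<and> i \<le> length \<alpha> - 1")
  case False
  hence "i = 0 \<or> i = length \<alpha>" using assms(2) by linarith
  hence "psum \<alpha> i \<notin> A" using assms(1) Suc_fence_size by fastforce
  thus ?thesis using False by (auto simp: chi_shared_def chi_def)
qed (simp add: chi_shared_def shared_elem_def)

text \<open>The first segment ascends from 1, so exactly 1, ..., x lie weakly below its unshared
  element x, and rank equals index.\<close>

lemma unshared_elem_first_segment:
  assumes j: "j \<in> {1..\<alpha> ! 0 - 1}"
  shows "unshared_elem \<alpha> 1 j = j"
proof -
  have one: "1 \<in> {1..length \<alpha>}" using comp by (auto simp: fence_composition_def Suc_le_eq)
  have "psum \<alpha> 1 = \<alpha> ! 0" using psum_pred[OF one] by simp
  hence U: "unshared \<alpha> 1 = {1..\<alpha> ! 0 - 1}" by (auto simp only: unshared_eq[OF one]) auto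
  have down: "(z, x) \<in> fence \<alpha> \<longleftrightarrow> 1 \<le> z \<and> z \<le> x" if "x \<in> unshared \<alpha> 1" for x z
    using that
  proof (induction x)
    case (Suc x)
    have cover: "(y, Suc x) \<in> fence_covers \<alpha> \<longleftrightarrow> y \<in> {1..fence_size \<alpha>} \<and> y = x" for y
      using unshared_covers_iff(2)[OF one Suc.prems] by simp
    have n: "Suc x \<le> fence_size \<alpha>" using subsetD[OF unshared_subset_fence Suc.prems] by simp
    have step: "(z, Suc x) \<in> fence \<alpha> \<longleftrightarrow> z = Suc x \<or> 1 \<le> x \<and> (z, x) \<in> fence \<alpha>"
      using n unfolding fence_down_iff[of z "Suc x"] cover by auto
    show ?case
    proof (cases "x = 0")
      case False
      hence "x \<in> unshared \<alpha> 1" using Suc.prems U by auto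
      from step Suc.IH[OF this] False show ?thesis by auto
    qed (use step in auto)
  qed (simp only: U, simp)
  have "under (fence \<alpha>) x \<inter> unshared \<alpha> 1 = {1..x}" if x: "x \<in> unshared \<alpha> 1" for x
    using x U down[OF x] by (auto simp: under_def)
  thus ?thesis unfolding unshared_elem_def using j U by (intro the_equality) auto
qed

section \<open>Orbit sums on a fence\<close>

context
  fixes A :: "nat set" and \<O>
  assumes A: "A \<in> antichains (fence \<alpha>)"
  defines "\<O> \<equiv> orbit (row_antichain (fence \<alpha>)) A"
begin

lemma orbit_antichain: "B \<in> \<O> \<Longrightarrow> B \<in> antichains (fence \<alpha>)"
  using antichain_orbit_subset[OF finite_Field_fence partial_order_on_fence A]
  by (auto simp: \<O>_def)

lemma orbit_subset_fence: "B \<in> \<O> \<Longrightarrow> B \<subseteq> {1..fence_size \<alpha>}"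
  using orbit_antichain Field_fence by (auto simp: antichains_def)

lemma sum_orbit_outside: "k \<notin> {1..fence_size \<alpha>} \<Longrightarrow> (\<Sum>B\<in>\<O>. chi k B) = 0"
  using orbit_subset_fence by (intro sum.neutral) (force simp: chi_def indicator_def)

lemma sum_orbit_chain:
  assumes "i \<in> {1..length \<alpha>}" "2 \<le> \<alpha> ! (i - 1)" "j \<le> \<alpha> ! (i - 1)"
  shows "(\<Sum>B\<in>\<O>. segment_chi (fence \<alpha>) (fence_chain \<alpha> i) j (ideal_gen (fence \<alpha>) B)) =
    real (card \<O>) - (\<Sum>B\<in>\<O>. chi (fence_chain \<alpha> i 0) B) -
      real j * (\<Sum>B\<in>\<O>. chi (fence_chain \<alpha> i 1) B)"
  unfolding \<O>_def
  using sum_segment_chi[OF finite_Field_fence partial_order_on_fence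
      poset_segment_fence[OF assms(1)] A assms(2,3)] .

text \<open>An unshared element is counted by the difference of two consecutive terms of the
  progression, which does not depend on its position. This gives (a).\<close>

lemma sum_orbit_unshared:
  assumes i: "i \<in> {1..length \<alpha>}" and x: "x \<in> unshared \<alpha> i"
  shows "(\<Sum>B\<in>\<O>. chi x B) = (\<Sum>B\<in>\<O>. chi (fence_chain \<alpha> i 1) B)"
proof -
  let ?c = "fence_chain \<alpha> i"
  obtain j where j: "0 < j" "j < \<alpha> ! (i - 1)" "x = ?c j"
    using x unfolding fence_chain_unshared[OF i, symmetric] by auto
  \<comment> \<open>The existence of an inner position forces the part to be at least 2.\<close>
  hence l: "2 \<le> \<alpha> ! (i - 1)" "j \<le> \<alpha> ! (i - 1)" "Suc j \<le> \<alpha> ! (i - 1)" by linarith+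
  have "(\<Sum>B\<in>\<O>. chi x B) = (\<Sum>B\<in>\<O>. segment_chi (fence \<alpha>) ?c j (ideal_gen (fence \<alpha>) B) -
      segment_chi (fence \<alpha>) ?c (Suc j) (ideal_gen (fence \<alpha>) B))"
    unfolding j(3)
    by (intro sum.cong refl chi_antichain_segment[OF finite_Field_fence partial_order_on_fence
          poset_segment_fence[OF i] orbit_antichain j(1,2)])
  also have "\<dots> = (\<Sum>B\<in>\<O>. chi (?c 1) B)"
    unfolding sum_subtractf sum_orbit_chain[OF i l(1,2)] sum_orbit_chain[OF i l(1,3)]
    by (simp add: algebra_simps)
  finally show ?thesis .
qed

text \<open>The last term of the progression counts the antichains containing the top, which closes
  it into a linear relation. This gives (b) and drives (e) and (f).\<close>

lemma sum_orbit_segment: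
  assumes i: "i \<in> {1..length \<alpha>}" and x: "x \<in> unshared \<alpha> i"
  shows "real (\<alpha> ! (i - 1)) * (\<Sum>B\<in>\<O>. chi x B) + (\<Sum>B\<in>\<O>. chi (psum \<alpha> i) B) +
    (\<Sum>B\<in>\<O>. chi (psum \<alpha> (i - 1)) B) = real (card \<O>)"
proof -
  let ?c = "fence_chain \<alpha> i" and ?l = "\<alpha> ! (i - 1)"
  have l: "2 \<le> ?l" using x psum_pred[OF i] unfolding unshared_eq[OF i] by auto
  hence "(\<Sum>B\<in>\<O>. chi (?c ?l) B) =
      (\<Sum>B\<in>\<O>. segment_chi (fence \<alpha>) ?c ?l (ideal_gen (fence \<alpha>) B))"
    by (intro sum.cong refl chi_antichain_segment_top[OF finite_Field_fence
          partial_order_on_fence poset_segment_fence[OF i]] orbit_antichain) auto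
  hence "real ?l * (\<Sum>B\<in>\<O>. chi x B) + (\<Sum>B\<in>\<O>. chi (?c ?l) B) + (\<Sum>B\<in>\<O>. chi (?c 0) B) =
      real (card \<O>)"
    using sum_orbit_chain[OF i l order_refl] sum_orbit_unshared[OF i x] by simp
  \<comment> \<open>Parity decides which end is the top, but the relation is symmetric in the two
    ends.\<close>
  moreover have "?c ?l = psum \<alpha> i \<and> ?c 0 = psum \<alpha> (i - 1) \<or>
      ?c ?l = psum \<alpha> (i - 1) \<and> ?c 0 = psum \<alpha> i"
    by (rule fence_chain_params[OF i]) simp
  ultimately show ?thesis by auto
qed

text \<open>The bottom of the first segment is the absent element 0, so the progression starts at
  the orbit size.\<close>

lemma sum_orbit_first_segment_ideal:
  assumes j: "j \<in> {1..\<alpha> ! 0 - 1}"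
  shows "(\<Sum>B\<in>\<O>. chi (unshared_elem \<alpha> 1 j) (ideal_gen (fence \<alpha>) B)) =
    real (card \<O>) - real j * (\<Sum>B\<in>\<O>. chi 1 B)"
proof -
  have one: "1 \<in> {1..length \<alpha>}" using comp by (auto simp: fence_composition_def Suc_le_eq)
  have c: "fence_chain \<alpha> 1 k = k" for k by (simp add: fence_chain_def)
  have "2 \<le> \<alpha> ! (1 - 1)" "j \<le> \<alpha> ! (1 - 1)" using j by auto
  thus ?thesis
    using sum_orbit_chain[OF one, of j] sum_orbit_outside[of 0] j
    unfolding c segment_chi_def unshared_elem_first_segment[OF j] by simp
qed

lemma sum_orbit_maximal_shared_ideal:
  assumes "odd i"
  shows "(\<Sum>B\<in>\<O>. chi (psum \<alpha> i) (ideal_gen (fence \<alpha>) B)) = (\<Sum>B\<in>\<O>. chi (psum \<alpha> i) B)"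
  using maximal_mem_iff_ideal_gen[OF finite_Field_fence partial_order_on_fence orbit_antichain
      shared_maximal[OF assms]]
  by (intro sum.cong) (auto simp: chi_def indicator_def)

text \<open>A minimal element lies in the image of \<open>B\<close> exactly when the ideal of
  \<open>B\<close> misses it; the shift then replaces images by \<open>B\<close> itself.\<close>

lemma sum_orbit_minimal_shared_ideal:
  assumes i: "even i" "psum \<alpha> i \<in> {1..fence_size \<alpha>}"
  shows "(\<Sum>B\<in>\<O>. chi (psum \<alpha> i) (ideal_gen (fence \<alpha>) B)) =
    real (card \<O>) - (\<Sum>B\<in>\<O>. chi (psum \<alpha> i) B)"
proof -
  have "(\<Sum>B\<in>\<O>. chi (psum \<alpha> i) (row_antichain (fence \<alpha>) B)) =
      (\<Sum>B\<in>\<O>. 1 - chi (psum \<alpha> i) (ideal_gen (fence \<alpha>) B))"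
    using row_antichain_minimal_mem_iff[OF finite_Field_fence partial_order_on_fence _
        shared_minimal[OF i(1)]] i(2)
    by (intro sum.cong) (auto simp: Field_fence chi_def indicator_def)
  thus ?thesis
    using sum_antichain_orbit_shift[OF finite_Field_fence partial_order_on_fence A,
        of "chi (psum \<alpha> i)"]
    by (simp add: \<O>_def sum_subtractf)
qed

lemma finite_orbit: "finite \<O>"
  unfolding \<O>_def
  by (rule finite_antichain_orbit[OF finite_Field_fence partial_order_on_fence A])

lemma red_count_eq: "real (red_count \<alpha> i \<O>) = (\<Sum>B\<in>\<O>. chi (psum \<alpha> i) B)"
  using finite_orbit
  by (simp add: red_count_def shared_elem_def chi_def indicator_def sum.If_cases Int_def
      flip: sum.inter_filter)

text \<open>Modulo 2 the segment relation reads r_(i-1) + r_i = #\<O>. From r_0 = 0 it follows that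
  r_i = i #\<O> modulo 2, and r_s = 0 with \<open>s\<close> odd makes #\<O> even.\<close>

lemma even_card_orbit:
  assumes "odd (length \<alpha>)" and parts: "\<forall>i\<in>{1..length \<alpha>}. even (\<alpha> ! (i - 1))"
  shows "even (card \<O>)"
proof -
  have red_outside: "red_count \<alpha> i \<O> = 0" if "psum \<alpha> i \<notin> {1..fence_size \<alpha>}" for i
    using red_count_eq[of i] sum_orbit_outside[OF that] by simp
  have parity: "even (red_count \<alpha> i \<O>) \<longleftrightarrow> even i \<or> even (card \<O>)" if "i \<le> length \<alpha>" for i
    using that
  proof (induction i)
    case (Suc i)
    hence i: "Suc i \<in> {1..length \<alpha>}" by auto
    \<comment> \<open>A positive even part is at least 2, so segment \<open>Suc i\<close> has an
      unshared element and the segment relation applies.\<close>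
    have "even (\<alpha> ! i)" "0 < \<alpha> ! i" using bspec[OF parts i] i part_pos[of i] by auto
    hence "\<alpha> ! i \<ge> 2" by (auto elim: evenE)
    hence x: "Suc (psum \<alpha> i) \<in> unshared \<alpha> (Suc i)"
      using psum_pred[OF i] unfolding unshared_eq[OF i] by auto
    define u where "u = card {B\<in>\<O>. Suc (psum \<alpha> i) \<in> B}"
    have U: "(\<Sum>B\<in>\<O>. chi (Suc (psum \<alpha> i)) B) = real u"
      using finite_orbit by (simp add: u_def chi_def indicator_def sum.If_cases Int_def)
    have "real (\<alpha> ! i * u + red_count \<alpha> (Suc i) \<O> + red_count \<alpha> i \<O>)
        = real (card \<O>)"
      using sum_orbit_segment[OF i x] red_count_eq[of "Suc i"] red_count_eq[of i]
      by (simp add: U)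
    hence "\<alpha> ! i * u + (red_count \<alpha> (Suc i) \<O> + red_count \<alpha> i \<O>) = card \<O>"
      by (simp only: of_nat_eq_iff add.assoc)
    hence "even (red_count \<alpha> (Suc i) \<O> + red_count \<alpha> i \<O>) \<longleftrightarrow> even (card \<O>)"
      using \<open>even (\<alpha> ! i)\<close> by (metis dvd_add_right_iff dvd_mult2)
    thus ?case using Suc by auto
  qed (simp add: red_outside)
  have "red_count \<alpha> (length \<alpha>) \<O> = 0"
    using red_outside Suc_fence_size by auto
  thus ?thesis using parity[of "length \<alpha>"] assms(1) by simp
qed

text \<open>The segment relations are added. An odd position is the only unshared element of its
  segment and has coefficient 2 there; an even position inside the fence occurs once in each of two
  segments. So every element is counted twice.\<close>

lemma sum_orbit_card_parts_2:
  assumes parts: "\<forall>i\<in>{1..length \<alpha>}. \<alpha> ! (i - 1) = 2"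
  shows "2 * (\<Sum>B\<in>\<O>. real (card B)) = real (length \<alpha>) * real (card \<O>)"
proof -
  let ?U = "\<lambda>k. \<Sum>B\<in>\<O>. chi k B"
  have p: "psum \<alpha> i = 2 * i" if "i \<le> length \<alpha>" for i
    using that by (induction i) (use parts psum_pred in force)+
  have "2 * ?U (2 * i - 1) + ?U (2 * i) + ?U (2 * (i - 1)) = real (card \<O>)"
    if i: "i \<in> {1..length \<alpha>}" for i
  proof -
    have "2 * i - 1 \<in> unshared \<alpha> i" using i by (auto simp: unshared_eq p)
    moreover have "psum \<alpha> i = 2 * i" "psum \<alpha> (i - 1) = 2 * (i - 1)" using i by (auto intro: p)
    ultimately show ?thesis using sum_orbit_segment[OF i] i parts by force
  qed
  hence "(\<Sum>i=1..length \<alpha>. 2 * ?U (2 * i - 1) + ?U (2 * i) + ?U (2 * (i - 1))) =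
      real (length \<alpha>) * real (card \<O>)" by simp
  \<comment> \<open>For the induction the sum stops at \<open>m\<close>; the corrections account for
    the end positions 0 and 2m, each of which has been met only once.\<close>
  moreover have "(\<Sum>i=1..m. 2 * ?U (2 * i - 1) + ?U (2 * i) + ?U (2 * (i - 1))) =
      2 * (\<Sum>k=1..2 * m. ?U k) - ?U (2 * m) + ?U 0" for m
    by (induction m) simp_all
  moreover have "?U 0 = 0"
    using sum_orbit_outside[of 0] by simp
  moreover have "?U (2 * length \<alpha>) = 0"
    using sum_orbit_outside Suc_fence_size p[of "length \<alpha>"] by simp
  \<comment> \<open>Double counting of pairs of an antichain and an element of it.\<close>
  moreover have "(\<Sum>k=1..2 * length \<alpha>. ?U k) = (\<Sum>B\<in>\<O>. real (card B))"
  proof (subst sum.swap, intro sum.cong refl)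
    fix B assume "B \<in> \<O>"
    hence B: "B \<subseteq> {1..2 * length \<alpha>}"
      using orbit_subset_fence Suc_fence_size p[of "length \<alpha>"] by fastforce
    show "(\<Sum>k=1..2 * length \<alpha>. chi k B) = real (card B)"
      using B by (simp add: chi_def indicator_def sum.If_cases Int_absorb1)
  qed
  ultimately show ?thesis by simp
qed

end

end

section \<open>Deduction of the six statements\<close>

theorem theorem3p1:
  fixes \<alpha> :: "nat list" and s :: nat
  assumes "fence_composition \<alpha>" and "s = length \<alpha>"
  shows
    "(\<forall>i\<in>{1..s}. \<forall>x\<in>unshared \<alpha> i. \<forall>y\<in>unshared \<alpha> i.
        mesic (antichain_orbits (fence \<alpha>)) (\<lambda>A. chi x A - chi y A) 0)
   \<and> (\<forall>i\<in>{1..s}. \<forall>x\<in>unshared \<alpha> i.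
        mesic (antichain_orbits (fence \<alpha>))
          (\<lambda>A. real (\<alpha> ! (i - 1)) * chi x A + chi_shared \<alpha> i A + chi_shared \<alpha> (i - 1) A) 1)
   \<and> (\<forall>j\<in>{1..\<alpha> ! 0 - 1}. \<forall>k\<in>{1..\<alpha> ! 0 - 1}.
        mesic (ideal_orbits (fence \<alpha>))
          (\<lambda>I. real k * chi (unshared_elem \<alpha> 1 j) I - real j * chi (unshared_elem \<alpha> 1 k) I)
          (real k - real j))
   \<and> (\<forall>i j. 1 \<le> i \<and> 2 * i - 1 \<le> s - 1 \<and> 1 \<le> j \<and> 2 * j \<le> s - 1 \<longrightarrow>
        (\<forall>\<O>\<in>antichain_orbits (fence \<alpha>). red_count \<alpha> (2 * i - 1) \<O> = red_count \<alpha> (2 * j) \<O>) \<longrightarrow>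
        mesic (ideal_orbits (fence \<alpha>))
          (\<lambda>I. chi (shared_elem \<alpha> (2 * i - 1)) I + chi (shared_elem \<alpha> (2 * j)) I) 1)
   \<and> (odd s \<and> (\<forall>i\<in>{1..s}. even (\<alpha> ! (i - 1))) \<longrightarrow>
        (\<forall>\<O>\<in>antichain_orbits (fence \<alpha>). even (card \<O>)) \<and>
        (\<forall>\<O>\<in>ideal_orbits (fence \<alpha>). even (card \<O>)))
   \<and> ((\<forall>i\<in>{1..s}. \<alpha> ! (i - 1) = 2) \<longrightarrow>
        mesic (antichain_orbits (fence \<alpha>)) (\<lambda>A. real (card A)) (real s / 2))"
proof -
  let ?r = "fence \<alpha>"
  let ?O = "\<lambda>A. orbit (row_antichain ?r) A"
  note comp = assms(1) and s = assms(2)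
  note pos = finite_Field_fence[of \<alpha>] partial_order_on_fence[of \<alpha>]
  note mesic_iff = mesic_antichain_orbits_iff[OF pos] mesic_ideal_orbits_iff[OF pos]
  note sums = sum.distrib sum_subtractf sum_distrib_left[symmetric]
  have a: "mesic (antichain_orbits ?r) (\<lambda>A. chi x A - chi y A) 0"
    if "i \<in> {1..s}" "x \<in> unshared \<alpha> i" "y \<in> unshared \<alpha> i" for i x y
    using that sum_orbit_unshared[OF comp] by (simp add: mesic_iff sums s)
  have b: "mesic (antichain_orbits ?r)
      (\<lambda>A. real (\<alpha> ! (i - 1)) * chi x A + chi_shared \<alpha> i A + chi_shared \<alpha> (i - 1) A) 1"
    if i: "i \<in> {1..s}" and x: "x \<in> unshared \<alpha> i" for i x
  proof -
    have "(\<Sum>B\<in>?O A. real (\<alpha> ! (i - 1)) * chi x B + chi_shared \<alpha> i B + chi_shared \<alpha> (i - 1) B)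
        = real (card (?O A))" if A: "A \<in> antichains ?r" for A
    proof -
      have "(\<Sum>B\<in>?O A. chi_shared \<alpha> k B) = (\<Sum>B\<in>?O A. chi (psum \<alpha> k) B)" if "k \<le> s" for k
        using that orbit_subset_fence[OF comp A] chi_shared_eq[OF comp] s by (intro sum.cong) auto
      moreover have "i \<le> s" "i - 1 \<le> s" using i by auto
      ultimately show ?thesis
        using sum_orbit_segment[OF comp A, of i x] i x s unfolding sums by simp
    qed
    thus ?thesis by (simp add: mesic_iff)
  qed
  have c: "mesic (ideal_orbits ?r)
      (\<lambda>I. real k * chi (unshared_elem \<alpha> 1 j) I - real j * chi (unshared_elem \<alpha> 1 k) I)
      (real k - real j)" if jk: "j \<in> {1..\<alpha> ! 0 - 1}" "k \<in> {1..\<alpha> ! 0 - 1}" for j k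
    unfolding mesic_iff sums
  proof
    fix A assume A: "A \<in> antichains ?r"
    \<comment> \<open>With u the count of the element 1, the multiples of u cancel in k (#\<O> - j
      u) - j (#\<O> - k u).\<close>
    show "real k * (\<Sum>B\<in>?O A. chi (unshared_elem \<alpha> 1 j) (ideal_gen ?r B)) -
        real j * (\<Sum>B\<in>?O A. chi (unshared_elem \<alpha> 1 k) (ideal_gen ?r B)) =
        (real k - real j) * real (card (?O A))"
      unfolding sum_orbit_first_segment_ideal[OF comp A jk(1)]
        sum_orbit_first_segment_ideal[OF comp A jk(2)]
      by (simp add: algebra_simps)
  qed
  have d: "mesic (ideal_orbits ?r)
      (\<lambda>I. chi (shared_elem \<alpha> (2 * i - 1)) I + chi (shared_elem \<alpha> (2 * j)) I) 1"
    if ij: "1 \<le> i" "1 \<le> j" "2 * j \<le> s - 1"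
      and red: "\<forall>\<O>\<in>antichain_orbits ?r. red_count \<alpha> (2 * i - 1) \<O> = red_count \<alpha> (2 * j) \<O>"
    for i j
  proof -
    \<comment> \<open>The bounds on \<open>j\<close> place p_(2j) strictly between p_0 = 0 and p_s =
      n + 1, so it is an element of the fence.\<close>
    have "psum \<alpha> 1 \<le> psum \<alpha> (2 * j)" "psum \<alpha> (2 * j) \<le> psum \<alpha> (s - 1)"
      using ij psum_mono by auto
    moreover have "psum \<alpha> 0 < psum \<alpha> 1" "psum \<alpha> (s - 1) < psum \<alpha> s"
      using psum_pred_less[OF comp, of 1] psum_pred_less[OF comp, of s] ij s by auto
    ultimately have "psum \<alpha> (2 * j) \<in> {1..fence_size \<alpha>}"
      using Suc_fence_size[OF comp] s by auto
    note min = sum_orbit_minimal_shared_ideal[OF comp _ _ this]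
    have "(\<Sum>B\<in>?O A. chi (psum \<alpha> (2 * i - 1)) B) = (\<Sum>B\<in>?O A. chi (psum \<alpha> (2 * j)) B)"
      if "A \<in> antichains ?r" for A
      using red that red_count_eq[OF comp that, symmetric] by (auto simp: antichain_orbits_def)
    \<comment> \<open>With common red count u, the ideals contain the maximal element u times and
      the minimal one #\<O> - u times.\<close>
    thus ?thesis
      using ij(1) min sum_orbit_maximal_shared_ideal[OF comp, of _ "2 * i - 1"]
      unfolding mesic_iff sums by (simp add: shared_elem_def)
  qed
  have e: "(\<forall>\<O>\<in>antichain_orbits ?r. even (card \<O>)) \<and> (\<forall>\<O>\<in>ideal_orbits ?r. even (card \<O>))"
    if "odd s" "\<forall>i\<in>{1..s}. even (\<alpha> ! (i - 1))"
  proof -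
    have "even (card (?O A))" if "A \<in> antichains ?r" for A
      using even_card_orbit[OF comp that] \<open>odd s\<close> \<open>\<forall>i\<in>{1..s}. even (\<alpha> ! (i - 1))\<close> s by blast
    thus ?thesis
      using inj_on_ideal_gen_orbit[OF pos]
      by (auto simp: ideal_orbits_eq[OF pos] antichain_orbits_def card_image)
  qed
  have f: "mesic (antichain_orbits ?r) (\<lambda>A. real (card A)) (real s / 2)"
    if "\<forall>i\<in>{1..s}. \<alpha> ! (i - 1) = 2"
    using sum_orbit_card_parts_2[OF comp] that s by (fastforce simp: mesic_iff)
  show ?thesis
    by (intro conjI ballI allI impI; (elim conjE)?) (rule a b c d f | use e in blast; assumption)+
qed

end
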